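(* Let $\mathcal{L}:X\times S\to(-\infty,+\infty]$ be convex in its first variable and concave in its second variable, and suppose that $(x^\star,s^\star)\in X\times S$ is a saddle point of $\mathcal{L}$. Let $\{u^k\}_{k\ge 0}\subset X$ and $\{t^k\}_{k\ge 0}\subset S$ be sequences. Assume that, for every fixed test pair $(x,s)\in X\times S$, there exist a real sequence $(D_k(x,s))_{k\ge0}$, a real sequence $(R_k)_{k\ge0}$, a nonnegative nonincreasing real sequence $(V_k)_{k\ge0}$, and constants $\rho\ge 0$, $\kappa\ge 0$ and $B(x,s)\ge 0$ such that, for all $k\ge 0$, $$\mathcal{L}(u^k,s)-\mathcal{L}(x,t^k)\le D_k(x,s)-D_{k+1}(x,s)+R_k,$$ $$R_k\le \rho\,(V_k-V_{k+1}),$$ $$D_k(x,s)\ge -\kappa V_k-B(x,s).$$ Define, for $K\ge 1$, $$\bar u^K:=\frac1K\sum_{k=0}^{K-1}u^k,\qquad \bar t^K:=\frac1K\sum_{k=0}^{K-1}t^k.$$ Then, for all $K\ge 1$ and every test pair $(x,s)$ (with the corresponding sequences and constants), $$\mathcal{L}(\bar u^K,s)-\mathcal{L}(x,\bar t^K)\le \frac{D_0(x,s)+B(x,s)+(\rho+\kappa)V_0}{K}.$$ Consequently, for any test sets $\mathcal{X}\subset X$ and $\mathcal{S}\subset S$ for which the quantity $D_0(x,s)+B(x,s)+(\rho+\kappa)V_0$ is uniformly finite (bounded above uniformly over $(x,s)\in\mathcal{X}\times\mathcal{S}$), one has $$\mathcal{G}_{\mathcal{X},\mathcal{S}}(\bar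 u^K,\bar t^K):=\sup_{x\in\mathcal{X},\,s\in\mathcal{S}}\{\mathcal{L}(\bar u^K,s)-\mathcal{L}(x,\bar t^K)\}=O(1/K).$$ Moreover, if $(x^\star,s^\star)\in\mathcal{X}\times\mathcal{S}$, then $\mathcal{G}_{\mathcal{X},\mathcal{S}}(\bar u^K,\bar t^K)\ge 0$.
   Context: $X$ and $S$ are finite-dimensional real vector spaces (in the paper's use, $X=\mathbb{R}^n$ and $S=\mathbb{R}^m$). A saddle point of $\mathcal{L}$ is a pair $(x^\star,s^\star)$ with $\mathcal{L}(x^\star,s)\le \mathcal{L}(x^\star,s^\star)\le \mathcal{L}(x,s^\star)$ for all $x\in X$, $s\in S$. Differences of values of $\mathcal{L}$ are understood to be well defined (not of the form $\infty-\infty$) wherever they appear. *)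

theory Defs
  imports Complex_Main "HOL-Library.Extended_Real"
begin

text \<open>
  The library's \<open>convex_on\<close> and \<open>concave_on\<close> are for real-valued functions, hence the two
  definitions for \<open>ereal\<close> values. The weights are strictly positive, so the convention
  \<open>0 * \<infinity> = 0\<close> plays no role; for functions avoiding \<open>-\<infinity>\<close> no sum \<open>\<infinity> + (-\<infinity>)\<close> occurs.
\<close>

definition ereal_convex :: "('a::real_vector \<Rightarrow> ereal) \<Rightarrow> bool" where
  "ereal_convex f \<longleftrightarrow> (\<forall>x y. \<forall>a::real. 0 < a \<and> a < 1 \<longrightarrow>
     f ((1 - a) *\<^sub>R x + a *\<^sub>R y) \<le> ereal (1 - a) * f x + ereal a * f y)"

definition ereal_concave :: "('a::real_vector \<Rightarrow> ereal) \<Rightarrow> bool" where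
  "ereal_concave f \<longleftrightarrow> (\<forall>x y. \<forall>a::real. 0 < a \<and> a < 1 \<longrightarrow>
     ereal (1 - a) * f x + ereal a * f y \<le> f ((1 - a) *\<^sub>R x + a *\<^sub>R y))"

definition saddle_point :: "('a \<Rightarrow> 'b \<Rightarrow> ereal) \<Rightarrow> 'a \<Rightarrow> 'b \<Rightarrow> bool" where
  "saddle_point L xs ss \<longleftrightarrow> (\<forall>x s. L xs s \<le> L xs ss \<and> L xs ss \<le> L x ss)"

text \<open>Averages over the first \<open>K\<close> iterates, meant for \<open>K \<ge> 1\<close>.\<close>

definition ergodic_mean :: "(nat \<Rightarrow> 'a::real_vector) \<Rightarrow> nat \<Rightarrow> 'a" where
  "ergodic_mean u K = (1 / real K) *\<^sub>R (\<Sum>k<K. u k)"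

text \<open>
  Since \<open>\<infinity> - \<infinity> = \<infinity>\<close> in \<^typ>\<open>ereal\<close>, an upper bound by a real number on a difference of
  values in \<open>(-\<infinity>, \<infinity>]\<close> entails that the minuend is finite, so that the difference is well defined.
\<close>

definition gap :: "('a \<Rightarrow> 'b \<Rightarrow> ereal) \<Rightarrow> 'a set \<Rightarrow> 'b set \<Rightarrow> 'a \<Rightarrow> 'b \<Rightarrow> ereal" where
  "gap L X S u t = (SUP (x, s) \<in> X \<times> S. L u s - L x t)"

text \<open>Unlike class \<open>euclidean_space\<close>, this includes the zero space and fixes no inner product.\<close>

definition finite_dimensional :: "'a::real_vector itself \<Rightarrow> bool" where
  "finite_dimensional _ \<longleftrightarrow> (\<exists>B :: 'a set. finite B \<and> span B = UNIV)"

end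

theory Submission imports Defs begin

text \<open>
  Summing the one-step inequality telescopes \<open>D\<close> and \<open>V\<close>; Jensen's inequality in each variable
  passes to the averages. The one-step inequality forces \<open>L (u k) s\<close> to be finite, say equal to
  \<open>p k\<close>, and bounds \<open>L x (t k)\<close> below by a real number \<open>p k - d k\<close>. Averaging these real bounds
  instead of the values of \<open>L\<close> makes a separate treatment of \<open>L x (t k) = \<infinity>\<close> unnecessary.
\<close>

lemma ergodic_mean_1 [simp]: "ergodic_mean u (Suc 0) = u 0"
  by (simp add: ergodic_mean_def)

text \<open>The induction step for Jensen's inequality: for \<open>K \<ge> 1\<close> both weights
  lie strictly between 0 and 1, as \<open>ereal_convex\<close> and \<open>ereal_concave\<close>
  require.\<close>

lemma ergodic_mean_Suc:
  assumes "K \<ge> 1"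
  shows "ergodic_mean u (Suc K)
    = (1 - 1 / real (Suc K)) *\<^sub>R ergodic_mean u K + (1 / real (Suc K)) *\<^sub>R u K"
proof -
  have "(1 - 1 / real (Suc K)) * (1 / real K) = 1 / real (Suc K)"
    using assms by (simp add: field_simps)
  then show ?thesis
    by (simp add: ergodic_mean_def scaleR_add_right del: of_nat_Suc)
qed

lemma ereal_convex_ergodic_mean_le:
  fixes f :: "'a::real_vector \<Rightarrow> ereal"
  assumes f: "ereal_convex f" and le: "\<And>k. f (u k) \<le> ereal (a k)" and "K \<ge> 1"
  shows "f (ergodic_mean u K) \<le> ereal (ergodic_mean a K)"
  using \<open>K \<ge> 1\<close>
\<comment> \<open>The induction starts at 1 because the mean over no iterates is the zero vector,
  about which \<open>le\<close> says nothing.\<close>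
proof (induction K rule: nat_induct_at_least)
  case base
  show ?case using le[of 0] by simp
next
  case (Suc K)
  define w where "w = 1 / real (Suc K)"
  have w: "0 < w" "w < 1"
    using Suc.hyps by (auto simp: w_def)
  have "f (ergodic_mean u (Suc K)) = f ((1 - w) *\<^sub>R ergodic_mean u K + w *\<^sub>R u K)"
    using Suc.hyps by (simp only: ergodic_mean_Suc w_def)
  also have "\<dots> \<le> ereal (1 - w) * f (ergodic_mean u K) + ereal w * f (u K)"
    using f w unfolding ereal_convex_def by blast
  also have "\<dots> \<le> ereal (1 - w) * ereal (ergodic_mean a K) + ereal w * ereal (a K)"
    using w by (intro add_mono ereal_mult_left_mono Suc.IH le) auto
  also have "\<dots> = ereal (ergodic_mean a (Suc K))"
    using Suc.hyps by (simp add: ergodic_mean_Suc w_def)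
  finally show ?case .
qed

text \<open>The same induction with the inequalities reversed. Only real lower bounds are averaged,
  so values \<infinity> of \<open>f\<close> are allowed.\<close>

lemma ereal_concave_ergodic_mean_ge:
  fixes f :: "'a::real_vector \<Rightarrow> ereal"
  assumes f: "ereal_concave f" and ge: "\<And>k. ereal (a k) \<le> f (u k)" and "K \<ge> 1"
  shows "ereal (ergodic_mean a K) \<le> f (ergodic_mean u K)"
  using \<open>K \<ge> 1\<close>
proof (induction K rule: nat_induct_at_least)
  case base
  show ?case using ge[of 0] by simp
next
  case (Suc K)
  define w where "w = 1 / real (Suc K)"
  have w: "0 < w" "w < 1"
    using Suc.hyps by (auto simp: w_def)
  have "ereal (ergodic_mean a (Suc K))
      = ereal (1 - w) * ereal (ergodic_mean a K) + ereal w * ereal (a K)"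
    using Suc.hyps by (simp add: ergodic_mean_Suc w_def)
  also have "\<dots> \<le> ereal (1 - w) * f (ergodic_mean u K) + ereal w * f (u K)"
    using w by (intro add_mono ereal_mult_left_mono Suc.IH ge) auto
  also have "\<dots> \<le> f ((1 - w) *\<^sub>R ergodic_mean u K + w *\<^sub>R u K)"
    using f w unfolding ereal_concave_def by blast
  also have "\<dots> = f (ergodic_mean u (Suc K))"
    using Suc.hyps by (simp only: ergodic_mean_Suc w_def)
  finally show ?case .
qed

text \<open>After telescoping, \<open>- D K\<close> is at most \<open>\<kappa> * V K + B\<close>,
  and \<open>V K \<le> V 0\<close> because \<open>V\<close> decreases; \<open>- \<rho> * V K\<close>
  is nonpositive and is dropped.\<close>

lemma sum_telescoping_residual_le:
  fixes D R V :: "nat \<Rightarrow> real"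
  assumes "decseq V" and "\<rho> \<ge> 0" and "\<kappa> \<ge> 0" and V: "\<And>k. V k \<ge> 0"
    and R: "\<And>k. R k \<le> \<rho> * (V k - V (Suc k))"
    and D: "\<And>k. D k \<ge> - \<kappa> * V k - B"
  shows "(\<Sum>k<K. D k - D (Suc k) + R k) \<le> D 0 + B + (\<rho> + \<kappa>) * V 0"
proof -
  have "(\<Sum>k<K. D k - D (Suc k) + R k)
      \<le> (\<Sum>k<K. (D k - D (Suc k)) + \<rho> * (V k - V (Suc k)))"
    by (intro sum_mono add_left_mono R)
  also have "\<dots> = D 0 - D K + \<rho> * (V 0 - V K)"
    by (simp only: sum.distrib sum_distrib_left[symmetric] sum_lessThan_telescope')
  also have "\<dots> \<le> D 0 + B + (\<rho> + \<kappa>) * V 0"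
  proof -
    have "\<kappa> * V K \<le> \<kappa> * V 0"
      using \<open>decseq V\<close> \<open>\<kappa> \<ge> 0\<close> by (intro mult_left_mono) (auto simp: decseq_def)
    moreover have "\<rho> * V K \<ge> 0"
      using \<open>\<rho> \<ge> 0\<close> V by simp
    ultimately show ?thesis
      using D[of K] by (simp add: algebra_simps)
  qed
  finally show ?thesis .
qed

text \<open>Confines the extended-real arithmetic to one place: \<open>d\<close> is an arbitrary
  real sequence, so the telescoping can be done separately in the reals.\<close>

lemma ergodic_gap_le:
  assumes ninf: "\<And>k. L (u k) s \<noteq> -\<infinity>"
    and conv: "ereal_convex (\<lambda>x. L x s)" and conc: "ereal_concave (\<lambda>s. L x s)"
    and step: "\<And>k. L (u k) s - L x (t k) \<le> ereal (d k)" and "K \<ge> 1"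
  shows "L (ergodic_mean u K) s - L x (ergodic_mean t K) \<le> ereal (ergodic_mean d K)"
proof -
  define p where "p k = real_of_ereal (L (u k) s)" for k
  have p: "L (u k) s = ereal (p k)" for k
    using ninf[of k] step[of k] by (cases "L (u k) s") (auto simp: p_def)
  \<comment> \<open>The value -\<infinity> on the right would make the difference in
    \<open>step\<close> equal to \<infinity>, contradicting its real bound; for the value
    \<infinity> the claim is trivial.\<close>
  have q: "ereal (p k - d k) \<le> L x (t k)" for k
    using step[of k] p[of k] by (cases "L x (t k)") auto
  have "L (ergodic_mean u K) s \<le> ereal (ergodic_mean p K)"
    using conv p \<open>K \<ge> 1\<close> by (intro ereal_convex_ergodic_mean_le) auto
  moreover have "ereal (ergodic_mean (\<lambda>k. p k - d k) K) \<le> L x (ergodic_mean t K)"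
    using conc q \<open>K \<ge> 1\<close> by (intro ereal_concave_ergodic_mean_ge) auto
  ultimately have "L (ergodic_mean u K) s - L x (ergodic_mean t K)
      \<le> ereal (ergodic_mean p K) - ereal (ergodic_mean (\<lambda>k. p k - d k) K)"
    by (rule ereal_minus_mono)
  \<comment> \<open>The mean is linear, so the auxiliary sequence \<open>p\<close> cancels.\<close>
  also have "\<dots> = ereal (ergodic_mean d K)"
    by (simp add: ergodic_mean_def sum_subtractf algebra_simps)
  finally show ?thesis .
qed

lemma gap_nonneg_if_saddle_point:
  assumes "saddle_point L xs ss" and "xs \<in> X" and "ss \<in> S"
  shows "gap L X S u t \<ge> 0"
proof -
  \<comment> \<open>Both sides are compared with the saddle value \<open>L xs ss\<close>.\<close>
  have "L xs t \<le> L u ss"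
    using \<open>saddle_point L xs ss\<close> unfolding saddle_point_def by (meson order_trans)
  \<comment> \<open>This holds for infinite values too, since equal infinities have difference
    \<infinity>.\<close>
  then have "0 \<le> L u ss - L xs t"
    by (rule ereal_diff_positive)
  also have "\<dots> \<le> gap L X S u t"
    unfolding gap_def using assms(2,3) by (intro SUP_upper2[of "(xs, ss)"]) auto
  finally show ?thesis .
qed

theorem theorem3p1:
  fixes L :: "'x::real_vector \<Rightarrow> 's::real_vector \<Rightarrow> ereal"
    and xstar :: 'x and sstar :: 's
    and u :: "nat \<Rightarrow> 'x" and t :: "nat \<Rightarrow> 's"
    and D R V :: "'x \<Rightarrow> 's \<Rightarrow> nat \<Rightarrow> real"
    and \<rho> \<kappa> B :: "'x \<Rightarrow> 's \<Rightarrow> real"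
  assumes "finite_dimensional TYPE('x)" and "finite_dimensional TYPE('s)"
    and "\<And>x s. L x s \<noteq> -\<infinity>"
    and "\<And>s. ereal_convex (\<lambda>x. L x s)"
    and "\<And>x. ereal_concave (\<lambda>s. L x s)"
    and "saddle_point L xstar sstar"
    and "\<And>x s k. V x s k \<ge> 0"
    and "\<And>x s. decseq (V x s)"
    and "\<And>x s. \<rho> x s \<ge> 0" and "\<And>x s. \<kappa> x s \<ge> 0" and "\<And>x s. B x s \<ge> 0"
    and "\<And>x s k. L (u k) s - L x (t k) \<le> ereal (D x s k - D x s (Suc k) + R x s k)"
    and "\<And>x s k. R x s k \<le> \<rho> x s * (V x s k - V x s (Suc k))"
    and "\<And>x s k. D x s k \<ge> - \<kappa> x s * V x s k - B x s"
  shows "(\<forall>K\<ge>1. \<forall>x s. L (ergodic_mean u K) s - L x (ergodic_mean t K)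
            \<le> ereal ((D x s 0 + B x s + (\<rho> x s + \<kappa> x s) * V x s 0) / real K))
       \<and> (\<forall>X S. (\<exists>M. \<forall>x\<in>X. \<forall>s\<in>S. D x s 0 + B x s + (\<rho> x s + \<kappa> x s) * V x s 0 \<le> M)
            \<longrightarrow> (\<exists>C. \<forall>K\<ge>1. gap L X S (ergodic_mean u K) (ergodic_mean t K) \<le> ereal (C / real K)))
       \<and> (\<forall>X S. xstar \<in> X \<and> sstar \<in> S
            \<longrightarrow> (\<forall>K\<ge>1. gap L X S (ergodic_mean u K) (ergodic_mean t K) \<ge> 0))"
proof (intro conjI allI impI)
  have bound: "L (ergodic_mean u K) s - L x (ergodic_mean t K)
      \<le> ereal ((D x s 0 + B x s + (\<rho> x s + \<kappa> x s) * V x s 0) / real K)"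
    if "K \<ge> 1" for K x s
  proof -
    let ?d = "\<lambda>k. D x s k - D x s (Suc k) + R x s k"
    have "L (ergodic_mean u K) s - L x (ergodic_mean t K) \<le> ereal (ergodic_mean ?d K)"
      using assms(3-5,12) that by (intro ergodic_gap_le) auto
    also have "ergodic_mean ?d K = sum ?d {..<K} / real K"
      by (simp add: ergodic_mean_def)
    also have "ereal \<dots> \<le> ereal ((D x s 0 + B x s + (\<rho> x s + \<kappa> x s) * V x s 0) / real K)"
      unfolding ereal_less_eq
      by (intro divide_right_mono sum_telescoping_residual_le assms(7-10,13,14)) simp
    finally show ?thesis .
  qed
  show "L (ergodic_mean u K) s - L x (ergodic_mean t K)
      \<le> ereal ((D x s 0 + B x s + (\<rho> x s + \<kappa> x s) * V x s 0) / real K)"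
    if "K \<ge> 1" for K x s
    using that by (rule bound)
  show "\<exists>C. \<forall>K\<ge>1. gap L X S (ergodic_mean u K) (ergodic_mean t K) \<le> ereal (C / real K)"
    if "\<exists>M. \<forall>x\<in>X. \<forall>s\<in>S. D x s 0 + B x s + (\<rho> x s + \<kappa> x s) * V x s 0 \<le> M" for X S
  proof -
    from that obtain M
      where M: "\<And>x s. x \<in> X \<Longrightarrow> s \<in> S \<Longrightarrow> D x s 0 + B x s + (\<rho> x s + \<kappa> x s) * V x s 0 \<le> M"
      by blast
    have "L (ergodic_mean u K) s - L x (ergodic_mean t K) \<le> ereal (M / real K)"
      if "K \<ge> 1" "x \<in> X" "s \<in> S" for K x s
      using bound[OF \<open>K \<ge> 1\<close>, of s x]
      by (rule order_trans) (simp add: M that divide_right_mono)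
    then show ?thesis
      \<comment> \<open>The uniform bound \<open>M\<close> itself is the O(1/K) constant, the same
        for all \<open>K\<close>. If a test set is empty, the supremum is -\<infinity> and the bound
        still holds.\<close>
      by (intro exI[of _ M]) (auto simp: gap_def intro!: SUP_least)
  qed
  show "gap L X S (ergodic_mean u K) (ergodic_mean t K) \<ge> 0"
    if "xstar \<in> X \<and> sstar \<in> S" for X S K
    using gap_nonneg_if_saddle_point[OF assms(6)] that by blast
qed

end
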